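(* Let $\mathbf{Z}$ be a real $m\times n$ random matrix with independent, zero-mean entries. Then \[ \mathbb{E}\|\mathbf{Z}\|_{\infty\to1}\le 2\,\mathbb{E}\left(\|\mathbf{Z}\|_{\mathrm{col}}+\|\mathbf{Z}^T\|_{\mathrm{col}}\right). \]
   Context: For a real $m\times n$ matrix $\mathbf{A}$ with columns $\mathbf{a}_1,\dots,\mathbf{a}_n$: $\|\mathbf{A}\|_{\infty\to1}=\max_{\mathbf{u}\ne\mathbf{0}}\|\mathbf{A}\mathbf{u}\|_1/\|\mathbf{u}\|_\infty$, and the column norm is $\|\mathbf{A}\|_{\mathrm{col}}=\sum_{k}\|\mathbf{a}_k\|_2$, the sum of the Euclidean norms of the columns. *)

theory Defs
  imports "HOL-Probability.Probability"
begin

definition l1norm :: "real ^ 'n \<Rightarrow> real" where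
  "l1norm x = (\<Sum>i\<in>UNIV. \<bar>x $ i\<bar>)"

(* The supremum is finite and attained (finite dimension, nonempty index types),
   so Sup is the maximum over nonzero u. *)
definition norm_inf_1 :: "real ^ 'n ^ 'm \<Rightarrow> real" where
  "norm_inf_1 A = (SUP u\<in>{u. u \<noteq> 0}. l1norm (A *v u) / infnorm u)"

definition colnorm :: "real ^ 'n ^ 'm \<Rightarrow> real" where
  "colnorm A = (\<Sum>k\<in>UNIV. norm (column k A))"

end

theory Submission imports Defs begin

text \<open>
  The norm is a maximum of \<open>S(Z, u) = \<Sum>i \<bar>\<Sum>j Z i j u j\<bar>\<close> over sign vectors \<open>u\<close>.
  Split \<open>S(Z, u)\<close> into its mean and its fluctuation.
  The maximal fluctuation is symmetrized over the rows of \<open>Z\<close> with an independent copy; the contraction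
  principle removes the inner absolute values, and what remains is
  \<open>2 \<Sum>j \<bar>\<Sum>i s i Z i j\<bar>\<close> averaged over signs \<open>s\<close>, at most twice the column norm by Cauchy-Schwarz.
  The mean is symmetrized row by row over single entries, which gives twice the column norm of the transpose.
\<close>

section \<open>Sign vectors and sums over all of them\<close>

text \<open>A uniformly distributed element of this finite set is a vector of independent random
  signs. Sums over \<open>signs\<close> thus replace averages over such a vector, at the price of
  the factor \<open>card signs\<close>, and no second probability space is needed for the
  signs.\<close>

definition signs :: "('k::finite \<Rightarrow> real) set" where
  "signs = {s. \<forall>k. s k = 1 \<or> s k = -1}"

lemma signs_eq_PiE: "signs = (\<Pi>\<^sub>E k\<in>UNIV. {1, -1})"
  by (auto simp: signs_def)

lemma finite_signs [simp]: "finite signs"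
  unfolding signs_eq_PiE by (intro finite_PiE) auto

lemma const_one_in_signs: "(\<lambda>_. 1) \<in> signs"
  by (simp add: signs_def)

lemma signs_nonempty [simp]: "signs \<noteq> {}"
  using const_one_in_signs by blast

lemma card_signs_pos: "0 < real (card (signs :: ('k::finite \<Rightarrow> real) set))"
  by (simp add: card_gt_0_iff)

lemma signsD: "s \<in> signs \<Longrightarrow> s k = 1 \<or> s k = -1"
  by (simp add: signs_def)

lemma abs_sign: "s \<in> signs \<Longrightarrow> \<bar>s k\<bar> = 1"
  using signsD[of s k] by auto

lemma sign_mult_le_abs: "s \<in> signs \<Longrightarrow> s k * a \<le> \<bar>a\<bar>"
  using signsD[of s k] by auto

lemma uminus_in_signs: "s \<in> signs \<Longrightarrow> (\<lambda>k. - s k) \<in> signs"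
  by (auto simp: signs_def)

lemma sum_signs_uminus: "(\<Sum>s\<in>signs. F (\<lambda>k. - s k)) = (\<Sum>s\<in>signs. F s)"
  by (rule sum.reindex_bij_witness[of _ "\<lambda>s k. - s k" "\<lambda>s k. - s k"])
    (auto simp: uminus_in_signs)

lemma sum_signs_flip: "(\<Sum>s\<in>signs. F (s(k := - s k))) = (\<Sum>s\<in>signs. F s)"
  by (rule sum.reindex_bij_witness[of _ "\<lambda>s. s(k := - s k)" "\<lambda>s. s(k := - s k)"])
    (auto simp: signs_def)

lemma exists_sign_vector:
  fixes a :: "'k::finite \<Rightarrow> real"
  obtains s where "s \<in> signs" "\<And>k. s k * a k = \<bar>a k\<bar>"
proof
  show "(\<lambda>k. if 0 \<le> a k then 1 else -1) \<in> signs"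
    by (auto simp: signs_def)
qed auto

text \<open>Flipping the sign at \<open>k\<close> permutes \<open>signs\<close> and negates each
  summand, so the sum equals its own negative.\<close>

lemma sum_signs_mult_eq_0:
  fixes k l :: "'k::finite"
  assumes "k \<noteq> l"
  shows "(\<Sum>s\<in>signs. s k * s l) = 0"
  using sum_signs_flip[of "\<lambda>s. s k * s l" k] assms by (simp add: sum_negf)

text \<open>Distinct coordinates of a random sign vector are orthogonal, so only the diagonal terms
  of the expanded square survive.\<close>

lemma sum_signs_square:
  fixes a :: "'k::finite \<Rightarrow> real"
  shows "(\<Sum>s\<in>signs. (\<Sum>k\<in>UNIV. s k * a k)\<^sup>2) =
    real (card (signs :: ('k \<Rightarrow> real) set)) * (\<Sum>k\<in>UNIV. (a k)\<^sup>2)"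
proof -
  have diag: "(\<Sum>s\<in>signs. s k * s l) = (if k = l then real (card (signs :: ('k \<Rightarrow> real) set)) else 0)"
    for k l :: 'k
  proof (cases "k = l")
    case True
    have "(\<Sum>s\<in>signs. s k * s k) = (\<Sum>s\<in>(signs :: ('k \<Rightarrow> real) set). 1)"
      by (rule sum.cong) (auto dest!: signsD[of _ k])
    with True show ?thesis by simp
  qed (simp add: sum_signs_mult_eq_0)
  have "(\<Sum>s\<in>signs. (\<Sum>k\<in>UNIV. s k * a k)\<^sup>2)
      = (\<Sum>s\<in>signs. \<Sum>k\<in>UNIV. \<Sum>l\<in>UNIV. a k * a l * (s k * s l))"
    by (simp add: power2_eq_square sum_product algebra_simps)
  also have "\<dots> = (\<Sum>k\<in>UNIV. \<Sum>l\<in>UNIV. a k * a l * (\<Sum>s\<in>signs. s k * s l))"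
    by (simp add: sum.swap[of _ _ "signs"] sum_distrib_left)
  also have "\<dots> = (\<Sum>k\<in>UNIV. a k * a k * real (card (signs :: ('k \<Rightarrow> real) set)))"
    by (intro sum.cong refl) (simp add: diag if_distrib cong: if_cong)
  also have "\<dots> = real (card (signs :: ('k \<Rightarrow> real) set)) * (\<Sum>k\<in>UNIV. (a k)\<^sup>2)"
    by (simp add: sum_distrib_left power2_eq_square algebra_simps)
  finally show ?thesis .
qed

text \<open>The easy direction of Khintchine's inequality, with constant 1: Cauchy-Schwarz against
  the constant 1 passes to second moments, which \<open>sum_signs_square\<close> evaluates
  exactly.\<close>

lemma sum_signs_abs_le:
  fixes a :: "'k::finite \<Rightarrow> real"
  shows "(\<Sum>s\<in>signs. \<bar>\<Sum>k\<in>UNIV. s k * a k\<bar>) \<le>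
    real (card (signs :: ('k \<Rightarrow> real) set)) * sqrt (\<Sum>k\<in>UNIV. (a k)\<^sup>2)"
proof -
  let ?c = "real (card (signs :: ('k \<Rightarrow> real) set))"
  have "(\<Sum>s\<in>signs. \<bar>\<Sum>k\<in>UNIV. s k * a k\<bar>) \<le>
      L2_set (\<lambda>_. 1) (signs :: ('k \<Rightarrow> real) set) * L2_set (\<lambda>s. \<Sum>k\<in>UNIV. s k * a k) signs"
    using L2_set_mult_ineq[of "\<lambda>_. 1" "\<lambda>s. \<Sum>k\<in>UNIV. s k * a k" "signs :: ('k \<Rightarrow> real) set"]
    by simp
  also have "\<dots> = sqrt ?c * (sqrt ?c * sqrt (\<Sum>k\<in>UNIV. (a k)\<^sup>2))"
    by (simp add: L2_set_def sum_signs_square real_sqrt_mult)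
  also have "\<dots> = ?c * sqrt (\<Sum>k\<in>UNIV. (a k)\<^sup>2)"
    by (simp add: mult.assoc[symmetric])
  finally show ?thesis .
qed

section \<open>Finite maxima and the contraction principle\<close>

lemma Max_image_obtain:
  fixes g :: "'u \<Rightarrow> real"
  assumes "finite U" "U \<noteq> {}"
  obtains u where "u \<in> U" "(MAX u\<in>U. g u) = g u"
  using Max_in[of "g ` U"] assms by fastforce

lemma Max_image_ge: "finite U \<Longrightarrow> u \<in> U \<Longrightarrow> g u \<le> (MAX u\<in>U. (g u :: real))"
  by simp

text \<open>The contraction principle for a single sign. Let \<open>u\<close> and \<open>v\<close>
  attain the two maxima on the left. If \<open>t u\<close> is nonnegative, use \<open>u\<close> as a
  candidate for the first maximum on the right and \<open>v\<close> for the second; otherwise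
  exchange their roles. The value at \<open>v\<close> may take either role because
  \<open>- \<bar>t v\<bar>\<close> is below both \<open>t v\<close> and
  \<open>- t v\<close>.\<close>

lemma Max_add_abs_le:
  fixes g t :: "'u \<Rightarrow> real"
  assumes U: "finite U" "U \<noteq> {}"
  shows "(MAX u\<in>U. g u + \<bar>t u\<bar>) + (MAX u\<in>U. g u - \<bar>t u\<bar>) \<le> (MAX u\<in>U. g u + t u) + (MAX u\<in>U. g u - t u)"
proof -
  obtain u where u: "u \<in> U" "(MAX u\<in>U. g u + \<bar>t u\<bar>) = g u + \<bar>t u\<bar>"
    using Max_image_obtain[OF U] .
  obtain v where v: "v \<in> U" "(MAX u\<in>U. g u - \<bar>t u\<bar>) = g v - \<bar>t v\<bar>"
    using Max_image_obtain[OF U] .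
  have plus: "g w + t w \<le> (MAX u\<in>U. g u + t u)" if "w \<in> U" for w
    using Max_image_ge[OF U(1) that] .
  have minus: "g w - t w \<le> (MAX u\<in>U. g u - t u)" if "w \<in> U" for w
    using Max_image_ge[OF U(1) that] .
  show ?thesis
    using u v plus[OF u(1)] minus[OF v(1)] plus[OF v(1)] minus[OF u(1)] by linarith
qed

text \<open>The set \<open>A\<close> records where absolute values already stand, so that induction
  inserts them one index at a time. For the new index \<open>x\<close>, pairing each
  \<open>s\<close> with its flip at \<open>x\<close> leaves exactly the two maxima of
  \<open>Max_add_abs_le\<close>.\<close>

lemma sum_signs_contraction_on:
  fixes t :: "'k::finite \<Rightarrow> 'u \<Rightarrow> real"
  assumes U: "finite U" "U \<noteq> {}"
  shows "(\<Sum>s\<in>signs. MAX u\<in>U. \<Sum>k\<in>UNIV. s k * (if k \<in> A then \<bar>t k u\<bar> else t k u)) \<le>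
    (\<Sum>s\<in>signs. MAX u\<in>U. \<Sum>k\<in>UNIV. s k * t k u)"
proof -
  have "finite A" by simp
  then show ?thesis
  proof induction
    case (insert x A)
    let ?H = "\<lambda>A s. MAX u\<in>U. \<Sum>k\<in>UNIV. s k * (if k \<in> A then \<bar>t k u\<bar> else t k u)"
    have split: "(\<Sum>k\<in>UNIV. f k) = (\<Sum>k\<in>-{x}. f k) + f x" for f :: "'k \<Rightarrow> real"
      by (subst sum.remove[of _ x]) (auto simp: Compl_eq_Diff_UNIV)
    have flip: "(\<Sum>s\<in>signs. F s) = (\<Sum>s\<in>signs. F s + F (s(x := - s x))) / 2"
      for F :: "('k \<Rightarrow> real) \<Rightarrow> real"
      by (simp add: sum.distrib sum_signs_flip)
    have "?H (insert x A) s + ?H (insert x A) (s(x := - s x)) \<le> ?H A s + ?H A (s(x := - s x))"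
      if s: "s \<in> signs" for s
    proof -
      \<comment> \<open>The terms away from \<open>x\<close> are common to \<open>s\<close> and its
        flip; only the sign in front of the term at \<open>x\<close> differs.\<close>
      define g where "g u = (\<Sum>k\<in>-{x}. s k * (if k \<in> A then \<bar>t k u\<bar> else t k u))" for u
      have g': "(\<Sum>k\<in>-{x}. r k * (if k \<in> insert x A then \<bar>t k u\<bar> else t k u)) = g u"
        "(\<Sum>k\<in>-{x}. r k * (if k \<in> A then \<bar>t k u\<bar> else t k u)) = g u"
        if "\<forall>k. k \<noteq> x \<longrightarrow> r k = s k" for r u
        unfolding g_def by (rule sum.cong; use that in auto)+
      have 1: "?H (insert x A) r = (MAX u\<in>U. g u + r x * \<bar>t x u\<bar>)"
        "?H A r = (MAX u\<in>U. g u + r x * t x u)" if "\<forall>k. k \<noteq> x \<longrightarrow> r k = s k" for r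
        unfolding split g'[OF that] using insert.hyps by simp_all
      have same: "\<forall>k. k \<noteq> x \<longrightarrow> s k = s k" "\<forall>k. k \<noteq> x \<longrightarrow> (s(x := - s x)) k = s k"
        by simp_all
      show ?thesis
        unfolding 1[OF same(1)] 1[OF same(2)]
        using Max_add_abs_le[OF U, of g "t x"] signsD[OF s, of x] by auto
    qed
    then have "(\<Sum>s\<in>signs. ?H (insert x A) s) \<le> (\<Sum>s\<in>signs. ?H A s)"
      unfolding flip[of "?H (insert x A)"] flip[of "?H A"]
      by (intro divide_right_mono sum_mono) auto
    with insert.IH show ?case by simp
  qed simp
qed

lemma sum_signs_contraction:
  fixes t :: "'k::finite \<Rightarrow> 'u \<Rightarrow> real"
  assumes "finite U" "U \<noteq> {}"
  shows "(\<Sum>s\<in>signs. MAX u\<in>U. \<Sum>k\<in>UNIV. s k * \<bar>t k u\<bar>) \<le>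
    (\<Sum>s\<in>signs. MAX u\<in>U. \<Sum>k\<in>UNIV. s k * t k u)"
  using sum_signs_contraction_on[OF assms, of UNIV t] by simp

section \<open>From the operator norm to sign vectors\<close>

text \<open>A sign vector \<open>v\<close> turns the l1 norm of the image of \<open>x\<close> into a
  linear form in \<open>x\<close>. On the cube of radius \<open>infnorm x\<close> such a form is
  largest at the vertex whose signs agree with its coefficients.\<close>

lemma norm_inf_1_le_Max_signs:
  fixes A :: "real ^ 'n ^ 'm"
  shows "norm_inf_1 A \<le> (MAX u\<in>signs. \<Sum>i\<in>UNIV. \<bar>\<Sum>j\<in>UNIV. A $ i $ j * u j\<bar>)" (is "_ \<le> ?B")
  unfolding norm_inf_1_def
proof (rule cSUP_least)
  show "{u :: real ^ 'n. u \<noteq> 0} \<noteq> {}"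
    using zero_neq_one by blast
next
  fix x :: "real ^ 'n"
  assume "x \<in> {u. u \<noteq> 0}"
  then have pos: "0 < infnorm x" by (simp add: infnorm_pos_lt)
  obtain v where v: "v \<in> signs" "\<And>i. v i * (A *v x) $ i = \<bar>(A *v x) $ i\<bar>"
    using exists_sign_vector[of "\<lambda>i. (A *v x) $ i"] by blast
  \<comment> \<open>The coefficients of the linear form, that is, the row vector \<open>v\<close>
    times \<open>A\<close>.\<close>
  define b where "b j = (\<Sum>i\<in>UNIV. v i * A $ i $ j)" for j
  obtain s where s: "s \<in> signs" "\<And>j. s j * b j = \<bar>b j\<bar>"
    using exists_sign_vector[of b] by blast
  have swap: "(\<Sum>j\<in>UNIV. b j * y j) = (\<Sum>i\<in>UNIV. v i * (\<Sum>j\<in>UNIV. A $ i $ j * y j))" for y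
    unfolding b_def sum_distrib_left sum_distrib_right
    by (subst sum.swap) (simp add: mult.assoc)
  have "l1norm (A *v x) = (\<Sum>i\<in>UNIV. v i * (A *v x) $ i)"
    by (simp add: l1norm_def v)
  also have "\<dots> = (\<Sum>j\<in>UNIV. b j * x $ j)"
    by (simp add: swap matrix_vector_mult_def)
  also have "\<dots> \<le> (\<Sum>j\<in>UNIV. infnorm x * (b j * s j))"
  proof (rule sum_mono)
    fix j
    have "b j * x $ j \<le> \<bar>b j\<bar> * \<bar>x $ j\<bar>" by (metis abs_ge_self abs_mult)
    also have "\<dots> \<le> \<bar>b j\<bar> * infnorm x"
      by (intro mult_left_mono component_le_infnorm_cart) auto
    finally show "b j * x $ j \<le> infnorm x * (b j * s j)"
      using s(2)[of j] by (simp add: mult.commute)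
  qed
  also have "\<dots> = infnorm x * (\<Sum>i\<in>UNIV. v i * (\<Sum>j\<in>UNIV. A $ i $ j * s j))"
    by (simp add: swap sum_distrib_left[symmetric])
  also have "\<dots> \<le> infnorm x * (\<Sum>i\<in>UNIV. \<bar>\<Sum>j\<in>UNIV. A $ i $ j * s j\<bar>)"
    using pos abs_sign[OF v(1)]
    by (intro mult_left_mono sum_mono) (auto intro: order_trans[OF abs_ge_self] simp: abs_mult)
  also have "\<dots> \<le> infnorm x * ?B"
    using pos s(1) by (intro mult_left_mono Max_image_ge) auto
  finally show "l1norm (A *v x) / infnorm x \<le> ?B"
    using pos by (simp add: divide_le_eq mult.commute)
qed

section \<open>Integrability of finite maxima and Euclidean norms\<close>

lemma integrable_Max_image:
  fixes F :: "'u \<Rightarrow> 'a \<Rightarrow> real"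
  assumes U: "finite U" "U \<noteq> {}" and int: "\<And>u. u \<in> U \<Longrightarrow> integrable M (F u)"
  shows "integrable M (\<lambda>\<omega>. MAX u\<in>U. F u \<omega>)"
proof (rule Bochner_Integration.integrable_bound)
  show "integrable M (\<lambda>\<omega>. \<Sum>u\<in>U. \<bar>F u \<omega>\<bar>)"
    using int by auto
  show "(\<lambda>\<omega>. MAX u\<in>U. F u \<omega>) \<in> borel_measurable M"
    using int by (intro borel_measurable_Max U) auto
  show "AE \<omega> in M. norm (MAX u\<in>U. F u \<omega>) \<le> norm (\<Sum>u\<in>U. \<bar>F u \<omega>\<bar>)"
  proof (rule AE_I2)
    fix \<omega>
    obtain u where "u \<in> U" "(MAX u\<in>U. F u \<omega>) = F u \<omega>"
      using Max_image_obtain[OF U] .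
    then have "\<bar>MAX u\<in>U. F u \<omega>\<bar> \<le> (\<Sum>u\<in>U. \<bar>F u \<omega>\<bar>)"
      using member_le_sum[of u U "\<lambda>u. \<bar>F u \<omega>\<bar>"] U(1) by simp
    then show "norm (MAX u\<in>U. F u \<omega>) \<le> norm (\<Sum>u\<in>U. \<bar>F u \<omega>\<bar>)" by simp
  qed
qed

lemma Max_image_add_le:
  fixes f g :: "'u \<Rightarrow> real"
  assumes U: "finite U" "U \<noteq> {}"
  shows "(MAX u\<in>U. f u + g u) \<le> (MAX u\<in>U. f u) + (MAX u\<in>U. g u)"
proof -
  obtain u where "u \<in> U" "(MAX u\<in>U. f u + g u) = f u + g u"
    using Max_image_obtain[OF U] .
  then show ?thesis
    using Max_image_ge[OF U(1), of u f] Max_image_ge[OF U(1), of u g] by linarith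
qed

text \<open>The l1 norm dominates the Euclidean norm, so first moments suffice and no second moments
  have to be assumed.\<close>

lemma integrable_L2_set:
  fixes X :: "'k \<Rightarrow> 'a \<Rightarrow> real"
  assumes "\<And>k. k \<in> K \<Longrightarrow> integrable M (X k)"
  shows "integrable M (\<lambda>\<omega>. L2_set (\<lambda>k. X k \<omega>) K)"
proof (rule Bochner_Integration.integrable_bound)
  show "integrable M (\<lambda>\<omega>. \<Sum>k\<in>K. \<bar>X k \<omega>\<bar>)"
    using assms by auto
  show "(\<lambda>\<omega>. L2_set (\<lambda>k. X k \<omega>) K) \<in> borel_measurable M"
    using assms[THEN borel_measurable_integrable] unfolding L2_set_def
    by (intro measurable_compose[OF _ borel_measurable_sqrt] borel_measurable_sum borel_measurable_power)
  show "AE \<omega> in M. norm (L2_set (\<lambda>k. X k \<omega>) K) \<le> norm (\<Sum>k\<in>K. \<bar>X k \<omega>\<bar>)"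
    by (simp add: L2_set_nonneg sum_nonneg L2_set_le_sum_abs)
qed

section \<open>Independent copies and symmetrization\<close>

context prob_space
begin

lemma distr_pair_self_snd: "distr (M \<Otimes>\<^sub>M M) M snd = M"
proof -
  interpret pair_sigma_finite M M ..
  have "distr (M \<Otimes>\<^sub>M M) M snd = distr (distr (M \<Otimes>\<^sub>M M) (M \<Otimes>\<^sub>M M) (\<lambda>(x, y). (y, x))) M snd"
    by (subst distr_pair_swap[symmetric]) simp
  also have "\<dots> = distr (M \<Otimes>\<^sub>M M) M fst"
    by (subst distr_distr) (auto simp: comp_def case_prod_beta)
  finally show ?thesis by (simp add: distr_pair_fst)
qed

lemma
  fixes f :: "'a \<Rightarrow> real"
  assumes f: "integrable M f"
  shows integrable_pair_fst: "integrable (M \<Otimes>\<^sub>M M) (\<lambda>p. f (fst p))"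
    and integrable_pair_snd: "integrable (M \<Otimes>\<^sub>M M) (\<lambda>p. f (snd p))"
    and integral_pair_fst: "(\<integral>p. f (fst p) \<partial>(M \<Otimes>\<^sub>M M)) = expectation f"
    and integral_pair_snd: "(\<integral>p. f (snd p) \<partial>(M \<Otimes>\<^sub>M M)) = expectation f"
  using f integrable_distr_eq[of fst "M \<Otimes>\<^sub>M M" M f] integrable_distr_eq[of snd "M \<Otimes>\<^sub>M M" M f]
    integral_distr[of fst "M \<Otimes>\<^sub>M M" M f] integral_distr[of snd "M \<Otimes>\<^sub>M M" M f]
  by (simp_all add: distr_pair_fst distr_pair_self_snd)

text \<open>Jensen's inequality for the maximum: each mean is written as an integral over a second
  copy \<open>y\<close>, the maximum of the integrals is at most the integral of the maximum, and
  Fubini joins the two integrals.\<close>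

lemma expectation_Max_centered_le:
  fixes F :: "'u \<Rightarrow> 'a \<Rightarrow> real"
  assumes U: "finite U" "U \<noteq> {}" and int: "\<And>u. u \<in> U \<Longrightarrow> integrable M (F u)"
  shows "expectation (\<lambda>\<omega>. MAX u\<in>U. F u \<omega> - expectation (F u)) \<le>
    (\<integral>p. (MAX u\<in>U. F u (fst p) - F u (snd p)) \<partial>(M \<Otimes>\<^sub>M M))"
proof -
  interpret P: pair_sigma_finite M M ..
  let ?G = "\<lambda>p. MAX u\<in>U. F u (fst p) - F u (snd p)"
  have G: "integrable (M \<Otimes>\<^sub>M M) ?G"
    by (intro integrable_Max_image U Bochner_Integration.integrable_diff integrable_pair_fst integrable_pair_snd int)
  have "(MAX u\<in>U. F u x - expectation (F u)) \<le> (\<integral>y. ?G (x, y) \<partial>M)" for x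
  proof -
    obtain u where u: "u \<in> U" "(MAX u\<in>U. F u x - expectation (F u)) = F u x - expectation (F u)"
      using Max_image_obtain[OF U] .
    have "F u x - expectation (F u) = (\<integral>y. F u x - F u y \<partial>M)"
      using int[OF u(1)] by (simp add: prob_space)
    also have "\<dots> \<le> (\<integral>y. ?G (x, y) \<partial>M)"
      using int u(1) U
      by (intro integral_mono integrable_Max_image Bochner_Integration.integrable_diff integrable_const)
        (simp_all add: Max_image_ge[of U u "\<lambda>u. F u x - F u _"])
    finally show ?thesis using u by simp
  qed
  then have "expectation (\<lambda>x. MAX u\<in>U. F u x - expectation (F u)) \<le> (\<integral>x. (\<integral>y. ?G (x, y) \<partial>M) \<partial>M)"
    using int by (intro integral_mono integrable_Max_image U P.integrable_fst' G Bochner_Integration.integrable_diff) auto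
  also have "\<dots> = integral\<^sup>L (M \<Otimes>\<^sub>M M) ?G"
    by (rule P.integral_fst'[OF G])
  finally show ?thesis .
qed

text \<open>
  An independent pair of copies is realized on \<open>M \<Otimes>\<^sub>M M\<close> by the two projections. The index \<open>(k, b)\<close> is
  filled by the first copy iff \<open>b = c k\<close>, so \<open>c\<close> says which coordinates are exchanged; the
  resulting distribution does not depend on \<open>c\<close>.
\<close>

lemma distr_swap_independent_copy:
  fixes V :: "'k::finite \<Rightarrow> 'a \<Rightarrow> 's" and c :: "'k \<Rightarrow> bool"
  assumes indep: "indep_vars N V UNIV"
  shows "distr (M \<Otimes>\<^sub>M M) (\<Pi>\<^sub>M (k, b)\<in>UNIV. N k)
      (\<lambda>p (k, b). V k (if b = c k then fst p else snd p)) =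
    (\<Pi>\<^sub>M (k, b)\<in>UNIV. distr M (N k) (V k))"
    (is "distr _ ?N ?W = ?R")
proof -
  have V[measurable]: "V k \<in> measurable M (N k)" for k
    using indep by (simp add: indep_vars_def2)
  have W: "?W \<in> measurable (M \<Otimes>\<^sub>M M) ?N"
  proof (rule measurable_PiM_single')
    fix i :: "'k \<times> bool"
    show "(\<lambda>p. ?W p i) \<in> measurable (M \<Otimes>\<^sub>M M) (case i of (k, b) \<Rightarrow> N k)"
      by (cases i; cases "snd i = c (fst i)") auto
  qed (auto simp: PiE_def space_pair_measure intro!: measurable_space[OF V])
  have box: "emeasure M {\<omega>\<in>space M. \<forall>k. V k \<omega> \<in> B k} = (\<Prod>k\<in>UNIV. emeasure (distr M (N k) (V k)) (B k))"
    if B: "\<And>k. B k \<in> sets (N k)" for B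
  proof -
    have "{\<omega>\<in>space M. \<forall>k. V k \<omega> \<in> B k} = (\<Inter>k\<in>UNIV. V k -` B k \<inter> space M)" by auto
    then have "prob {\<omega>\<in>space M. \<forall>k. V k \<omega> \<in> B k} = (\<Prod>k\<in>UNIV. prob (V k -` B k \<inter> space M))"
      using indep_varsD_finite[OF indep, of B] B by simp
    then show ?thesis
      using B by (simp add: emeasure_distr emeasure_eq_measure prod_ennreal)
  qed
  have sigma_finite: "product_sigma_finite (\<lambda>(k, b :: bool). distr M (N k) (V k))"
    unfolding product_sigma_finite_def
    by (auto intro!: prob_space_distr prob_space_imp_sigma_finite V)
  show ?thesis
  proof (rule product_sigma_finite.PiM_eqI[OF sigma_finite])
    show "sets (distr (M \<Otimes>\<^sub>M M) ?N ?W) = sets ?R"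
      by (auto intro!: sets_PiM_cong)
  next
    fix A :: "'k \<times> bool \<Rightarrow> 's set"
    assume sets_A: "\<And>i. i \<in> UNIV \<Longrightarrow> A i \<in> sets (case i of (k, b) \<Rightarrow> distr M (N k) (V k))"
    have A: "A (k, b) \<in> sets (N k)" for k b
      using sets_A[of "(k, b)"] by simp
    have Pi: "Pi\<^sub>E UNIV A \<in> sets ?N"
      using A by (intro sets_PiM_I_finite) (simp_all split: prod.split)
    have "emeasure (distr (M \<Otimes>\<^sub>M M) ?N ?W) (Pi\<^sub>E UNIV A) =
        emeasure (M \<Otimes>\<^sub>M M) (?W -` (Pi\<^sub>E UNIV A) \<inter> space (M \<Otimes>\<^sub>M M))"
      using Pi by (rule emeasure_distr[OF W])
    \<comment> \<open>For each \<open>k\<close> the first copy fills only the slot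
      \<open>c k\<close> and the second only the other slot, so the preimage of a box is a
      rectangle.\<close>
    also have "?W -` (Pi\<^sub>E UNIV A) \<inter> space (M \<Otimes>\<^sub>M M) =
        {\<omega>\<in>space M. \<forall>k. V k \<omega> \<in> A (k, c k)} \<times> {\<omega>\<in>space M. \<forall>k. V k \<omega> \<in> A (k, \<not> c k)}"
      (is "?S = ?T")
    proof (rule set_eqI)
      fix p :: "'a \<times> 'a"
      have "(\<forall>b. V k (if b = c k then fst p else snd p) \<in> A (k, b)) \<longleftrightarrow>
          V k (fst p) \<in> A (k, c k) \<and> V k (snd p) \<in> A (k, \<not> c k)" for k
        by (cases "c k") (simp_all add: all_bool_eq conj_commute)
      then have "(\<forall>k b. V k (if b = c k then fst p else snd p) \<in> A (k, b)) \<longleftrightarrow>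
          (\<forall>k. V k (fst p) \<in> A (k, c k)) \<and> (\<forall>k. V k (snd p) \<in> A (k, \<not> c k))"
        by (simp only: all_conj_distrib)
      moreover have "p \<in> ?S \<longleftrightarrow> fst p \<in> space M \<and> snd p \<in> space M \<and>
          (\<forall>k b. V k (if b = c k then fst p else snd p) \<in> A (k, b))"
        by (cases p) (auto simp: space_pair_measure PiE_UNIV_domain Pi_iff)
      moreover have "p \<in> ?T \<longleftrightarrow> fst p \<in> space M \<and> snd p \<in> space M \<and>
          (\<forall>k. V k (fst p) \<in> A (k, c k)) \<and> (\<forall>k. V k (snd p) \<in> A (k, \<not> c k))"
        by (cases p) auto
      ultimately show "p \<in> ?S \<longleftrightarrow> p \<in> ?T" by blast
    qed
    also have "emeasure (M \<Otimes>\<^sub>M M) \<dots> =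
        emeasure M {\<omega>\<in>space M. \<forall>k. V k \<omega> \<in> A (k, c k)} *
        emeasure M {\<omega>\<in>space M. \<forall>k. V k \<omega> \<in> A (k, \<not> c k)}"
    proof (rule emeasure_pair_measure_Times)
      show "{\<omega>\<in>space M. \<forall>k. V k \<omega> \<in> A (k, c k)} \<in> sets M"
        "{\<omega>\<in>space M. \<forall>k. V k \<omega> \<in> A (k, \<not> c k)} \<in> sets M"
        using A by measurable
    qed
    also have "\<dots> = (\<Prod>k\<in>UNIV. emeasure (distr M (N k) (V k)) (A (k, c k)) *
        emeasure (distr M (N k) (V k)) (A (k, \<not> c k)))"
      by (simp add: box A prod.distrib)
    \<comment> \<open>Here \<open>c\<close> disappears: it only decides the order of the two factors
      belonging to \<open>k\<close>.\<close>
    also have "\<dots> = (\<Prod>k\<in>UNIV. \<Prod>b\<in>UNIV. emeasure (distr M (N k) (V k)) (A (k, b)))"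
    proof (rule prod.cong[OF refl])
      fix k
      show "emeasure (distr M (N k) (V k)) (A (k, c k)) * emeasure (distr M (N k) (V k)) (A (k, \<not> c k)) =
          (\<Prod>b\<in>UNIV. emeasure (distr M (N k) (V k)) (A (k, b)))"
        by (cases "c k") (simp_all add: UNIV_bool mult.commute)
    qed
    also have "\<dots> = (\<Prod>i\<in>UNIV. emeasure (case i of (k, b) \<Rightarrow> distr M (N k) (V k)) (A i))"
      by (subst prod.cartesian_product) (auto intro!: prod.cong)
    finally show "emeasure (distr (M \<Otimes>\<^sub>M M) ?N ?W) (Pi\<^sub>E UNIV A) =
      (\<Prod>i\<in>UNIV. emeasure (case i of (k, b) \<Rightarrow> distr M (N k) (V k)) (A i))" .
  qed auto
qed

text \<open>Both sides are integrals of \<open>g\<close> against the same product measure, which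
  mentions neither \<open>c\<close> nor \<open>d\<close>.\<close>

lemma integral_swap_independent_copy:
  fixes V :: "'k::finite \<Rightarrow> 'a \<Rightarrow> 's" and g :: "('k \<times> bool \<Rightarrow> 's) \<Rightarrow> real"
  assumes indep: "indep_vars N V UNIV"
    and g: "g \<in> borel_measurable (\<Pi>\<^sub>M (k, b)\<in>UNIV. N k)"
  shows "(\<integral>p. g (\<lambda>(k, b). V k (if b = c k then fst p else snd p)) \<partial>(M \<Otimes>\<^sub>M M)) =
    (\<integral>p. g (\<lambda>(k, b). V k (if b = d k then fst p else snd p)) \<partial>(M \<Otimes>\<^sub>M M))"
proof -
  have V[measurable]: "V k \<in> measurable M (N k)" for k
    using indep by (simp add: indep_vars_def2)
  have W: "(\<lambda>p (k, b). V k (if b = c k then fst p else snd p)) \<in>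
      measurable (M \<Otimes>\<^sub>M M) (\<Pi>\<^sub>M (k, b)\<in>UNIV. N k)" for c :: "'k \<Rightarrow> bool"
  proof (rule measurable_PiM_single')
    fix i :: "'k \<times> bool"
    show "(\<lambda>p. case i of (k, b) \<Rightarrow> V k (if b = c k then fst p else snd p)) \<in>
        measurable (M \<Otimes>\<^sub>M M) (case i of (k, b) \<Rightarrow> N k)"
      by (cases i; cases "snd i = c (fst i)") auto
  qed (auto simp: PiE_def space_pair_measure intro!: measurable_space[OF V])
  have "(\<integral>p. g (\<lambda>(k, b). V k (if b = c k then fst p else snd p)) \<partial>(M \<Otimes>\<^sub>M M)) =
     integral\<^sup>L (\<Pi>\<^sub>M (k, b)\<in>UNIV. distr M (N k) (V k)) g" for c
    unfolding distr_swap_independent_copy[OF indep, of c, symmetric]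
    by (rule integral_distr[symmetric, OF W g])
  then show ?thesis by simp
qed

text \<open>After centering is replaced by the difference of two copies, signs can be inserted
  freely because exchanging the copies at \<open>k\<close> negates the \<open>k\<close>-th
  difference. Separating the copies again costs the factor 2. The values of \<open>V k\<close> lie
  in an arbitrary space so that one \<open>V k\<close> can be a single entry or a whole row of a
  matrix.\<close>

lemma symmetrization:
  fixes V :: "'k::finite \<Rightarrow> 'a \<Rightarrow> 's" and f :: "'k \<Rightarrow> 'u \<Rightarrow> 's \<Rightarrow> real"
  assumes indep: "indep_vars N V UNIV"
    and U: "finite U" "U \<noteq> {}"
    and meas: "\<And>k u. u \<in> U \<Longrightarrow> f k u \<in> borel_measurable (N k)"
    and int: "\<And>k u. u \<in> U \<Longrightarrow> integrable M (\<lambda>\<omega>. f k u (V k \<omega>))"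
  shows "real (card (signs :: ('k \<Rightarrow> real) set)) * expectation (\<lambda>\<omega>. MAX u\<in>U.
      (\<Sum>k\<in>UNIV. f k u (V k \<omega>)) - expectation (\<lambda>\<omega>. \<Sum>k\<in>UNIV. f k u (V k \<omega>))) \<le>
    2 * (\<Sum>s\<in>signs. expectation (\<lambda>\<omega>. MAX u\<in>U. \<Sum>k\<in>UNIV. s k * f k u (V k \<omega>)))"
    (is "?c * ?L \<le> 2 * (\<Sum>s\<in>signs. ?R s)")
proof -
  let ?D = "\<lambda>s p u. \<Sum>k\<in>UNIV. s k * (f k u (V k (fst p)) - f k u (V k (snd p)))"
  let ?E = "\<lambda>s. \<integral>p. (MAX u\<in>U. ?D s p u) \<partial>(M \<Otimes>\<^sub>M M)"
  have L: "?L \<le> ?E (\<lambda>_. 1)"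
    using expectation_Max_centered_le[OF U, of "\<lambda>u \<omega>. \<Sum>k\<in>UNIV. f k u (V k \<omega>)"] int
    by (simp add: sum_subtractf)
  have E: "?E s = ?E (\<lambda>_. 1)" if s: "s \<in> signs" for s
  proof -
    \<comment> \<open>The slot \<open>True\<close> enters with plus and \<open>False\<close> with
      minus. Taking \<open>c k\<close> to be \<open>s k = 1\<close> puts the second copy into the
      slot \<open>True\<close> exactly where \<open>s k = -1\<close>.\<close>
    define g where "g w = (MAX u\<in>U. \<Sum>k\<in>UNIV. f k u (w (k, True)) - f k u (w (k, False)))"
      for w :: "'k \<times> bool \<Rightarrow> 's"
    have proj: "(\<lambda>w. w (k, b)) \<in> measurable (\<Pi>\<^sub>M (k, b)\<in>UNIV. N k) (N k)" for k :: 'k and b :: bool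
      using measurable_component_singleton[of "(k, b)" UNIV "\<lambda>(k, b). N k"] by simp
    have g: "g \<in> borel_measurable (\<Pi>\<^sub>M (k, b)\<in>UNIV. N k)"
      unfolding g_def
      by (intro borel_measurable_Max U borel_measurable_sum borel_measurable_diff
          measurable_compose[OF proj meas]) auto
    have *: "(MAX u\<in>U. ?D s p u) = g (\<lambda>(k, b). V k (if b = (s k = 1) then fst p else snd p))"
      if "s \<in> signs" for s p
    proof -
      have "s k * (h (V k (fst p)) - h (V k (snd p))) =
          h (V k (if True = (s k = 1) then fst p else snd p)) -
          h (V k (if False = (s k = 1) then fst p else snd p))" for k and h :: "'s \<Rightarrow> real"
        using signsD[OF that, of k] by auto
      then show ?thesis
        unfolding g_def by (simp only: prod.case)
    qed
    show ?thesis
      unfolding *[OF s] *[OF const_one_in_signs]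
      by (rule integral_swap_independent_copy[OF indep g])
  qed
  \<comment> \<open>The maximum of a difference is split between the copies; the second copy
    receives the signs \<open>- s\<close>. Summed over all \<open>s\<close>, both terms give the
    same total.\<close>
  have bound: "?E s \<le> ?R s + ?R (\<lambda>k. - s k)" for s
  proof -
    have int': "integrable M (\<lambda>\<omega>. MAX u\<in>U. \<Sum>k\<in>UNIV. r k * f k u (V k \<omega>))" for r
      using int by (intro integrable_Max_image U) auto
    have "?E s \<le> (\<integral>p. (MAX u\<in>U. \<Sum>k\<in>UNIV. s k * f k u (V k (fst p))) +
        (MAX u\<in>U. \<Sum>k\<in>UNIV. - s k * f k u (V k (snd p))) \<partial>(M \<Otimes>\<^sub>M M))"
    proof (rule integral_mono)
      show "integrable (M \<Otimes>\<^sub>M M) (\<lambda>p. MAX u\<in>U. ?D s p u)"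
        by (intro integrable_Max_image U Bochner_Integration.integrable_sum integrable_mult_right
            Bochner_Integration.integrable_diff integrable_pair_fst[OF int] integrable_pair_snd[OF int])
      show "integrable (M \<Otimes>\<^sub>M M) (\<lambda>p. (MAX u\<in>U. \<Sum>k\<in>UNIV. s k * f k u (V k (fst p))) +
        (MAX u\<in>U. \<Sum>k\<in>UNIV. - s k * f k u (V k (snd p))))"
        by (intro Bochner_Integration.integrable_add integrable_pair_fst[OF int'] integrable_pair_snd[OF int'])
      show "(MAX u\<in>U. ?D s p u) \<le> (MAX u\<in>U. \<Sum>k\<in>UNIV. s k * f k u (V k (fst p))) +
        (MAX u\<in>U. \<Sum>k\<in>UNIV. - s k * f k u (V k (snd p)))" for p
        using Max_image_add_le[OF U, of "\<lambda>u. \<Sum>k\<in>UNIV. s k * f k u (V k (fst p))"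
            "\<lambda>u. \<Sum>k\<in>UNIV. - s k * f k u (V k (snd p))"]
        by (simp add: sum.distrib[symmetric] algebra_simps)
    qed
    also have "\<dots> = ?R s + ?R (\<lambda>k. - s k)"
      by (subst Bochner_Integration.integral_add[OF integrable_pair_fst[OF int'] integrable_pair_snd[OF int']])
        (simp only: integral_pair_fst[OF int'] integral_pair_snd[OF int'])
    finally show ?thesis .
  qed
  have "?c * ?L \<le> ?c * ?E (\<lambda>_. 1)"
    using L by (intro mult_left_mono) auto
  also have "\<dots> = (\<Sum>s\<in>(signs :: ('k \<Rightarrow> real) set). ?E s)"
    using E by simp
  also have "\<dots> \<le> (\<Sum>s\<in>signs. ?R s + ?R (\<lambda>k. - s k))"
    by (intro sum_mono bound)
  also have "\<dots> = 2 * (\<Sum>s\<in>signs. ?R s)"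
    unfolding sum.distrib using sum_signs_uminus[of ?R] by simp
  finally show ?thesis .
qed

section \<open>Bounds for the mean and for the fluctuation\<close>

text \<open>An absolute value is a maximum over the two multipliers 1 and -1, so
  \<open>symmetrization\<close> applies with \<open>{1, -1}\<close> as index set. Zero means make
  the centering vanish, and \<open>sum_signs_abs_le\<close> bounds the signed sums; the signs in
  \<open>u\<close> drop out on squaring.\<close>

lemma expectation_abs_sum_le:
  fixes X :: "'k::finite \<Rightarrow> 'a \<Rightarrow> real"
  assumes indep: "indep_vars (\<lambda>_. borel) X UNIV"
    and int: "\<And>k. integrable M (X k)"
    and mean: "\<And>k. expectation (X k) = 0"
    and u: "u \<in> signs"
  shows "expectation (\<lambda>\<omega>. \<bar>\<Sum>k\<in>UNIV. X k \<omega> * u k\<bar>) \<le>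
    2 * expectation (\<lambda>\<omega>. L2_set (\<lambda>k. X k \<omega>) UNIV)"
proof -
  let ?c = "real (card (signs :: ('k \<Rightarrow> real) set))"
  have Max_sgn: "(MAX w\<in>{1, -1}. w * x) = \<bar>x\<bar>" for x :: real by (auto simp: max_def)
  have "?c * expectation (\<lambda>\<omega>. MAX w\<in>{1, -1}.
      (\<Sum>k\<in>UNIV. w * (X k \<omega> * u k)) - expectation (\<lambda>\<omega>. \<Sum>k\<in>UNIV. w * (X k \<omega> * u k))) \<le>
    2 * (\<Sum>s\<in>signs. expectation (\<lambda>\<omega>. MAX w\<in>{1, -1}. \<Sum>k\<in>UNIV. s k * (w * (X k \<omega> * u k))))"
    using int by (intro symmetrization[OF indep]) auto
  also have "expectation (\<lambda>\<omega>. MAX w\<in>{1, -1}.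
      (\<Sum>k\<in>UNIV. w * (X k \<omega> * u k)) - expectation (\<lambda>\<omega>. \<Sum>k\<in>UNIV. w * (X k \<omega> * u k))) =
      expectation (\<lambda>\<omega>. MAX w\<in>{1, -1}. w * (\<Sum>k\<in>UNIV. X k \<omega> * u k))"
    using int mean by (simp add: sum_distrib_left)
  also have "\<dots> = expectation (\<lambda>\<omega>. \<bar>\<Sum>k\<in>UNIV. X k \<omega> * u k\<bar>)"
    by (simp only: Max_sgn)
  also have "(\<Sum>s\<in>signs. expectation (\<lambda>\<omega>. MAX w\<in>{1, -1}. \<Sum>k\<in>UNIV. s k * (w * (X k \<omega> * u k)))) =
      (\<Sum>s\<in>signs. expectation (\<lambda>\<omega>. MAX w\<in>{1, -1}. w * (\<Sum>k\<in>UNIV. s k * (X k \<omega> * u k))))"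
    by (simp only: sum_distrib_left mult.left_commute)
  also have "\<dots> = (\<Sum>s\<in>signs. expectation (\<lambda>\<omega>. \<bar>\<Sum>k\<in>UNIV. s k * (X k \<omega> * u k)\<bar>))"
    by (simp only: Max_sgn)
  also have "\<dots> = expectation (\<lambda>\<omega>. \<Sum>s\<in>signs. \<bar>\<Sum>k\<in>UNIV. s k * (X k \<omega> * u k)\<bar>)"
    using int by (intro Bochner_Integration.integral_sum[symmetric]) auto
  also have "\<dots> \<le> expectation (\<lambda>\<omega>. ?c * L2_set (\<lambda>k. X k \<omega>) UNIV)"
  proof (rule integral_mono)
    fix \<omega>
    have "(X k \<omega> * u k)\<^sup>2 = (X k \<omega>)\<^sup>2" for k
      using signsD[OF u, of k] by auto
    then show "(\<Sum>s\<in>signs. \<bar>\<Sum>k\<in>UNIV. s k * (X k \<omega> * u k)\<bar>) \<le> ?c * L2_set (\<lambda>k. X k \<omega>) UNIV"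
      using sum_signs_abs_le[of "\<lambda>k. X k \<omega> * u k"] by (simp add: L2_set_def)
  qed (use int in \<open>auto intro!: integrable_mult_right integrable_L2_set\<close>)
  finally have "?c * expectation (\<lambda>\<omega>. \<bar>\<Sum>k\<in>UNIV. X k \<omega> * u k\<bar>) \<le>
      ?c * (2 * expectation (\<lambda>\<omega>. L2_set (\<lambda>k. X k \<omega>) UNIV))"
    by simp
  then show ?thesis
    using card_signs_pos[where 'k = 'k] by (simp only: mult_le_cancel_left_pos)
qed

text \<open>The units of symmetrization are whole rows, so there is one sign per row. After
  contraction the expression is linear in \<open>u\<close>; maximizing over \<open>u\<close>
  decouples the columns, and averaging over the row signs gives the Euclidean norm of each
  column.\<close>

lemma expectation_Max_centered_l1_le:
  fixes X :: "'m::finite \<times> 'n::finite \<Rightarrow> 'a \<Rightarrow> real"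
  assumes indep: "indep_vars (\<lambda>_. borel) X UNIV"
    and int: "\<And>p. integrable M (X p)"
  shows "expectation (\<lambda>\<omega>. MAX u\<in>signs. (\<Sum>i\<in>UNIV. \<bar>\<Sum>j\<in>UNIV. X (i, j) \<omega> * u j\<bar>) -
      expectation (\<lambda>\<omega>. \<Sum>i\<in>UNIV. \<bar>\<Sum>j\<in>UNIV. X (i, j) \<omega> * u j\<bar>)) \<le>
    2 * expectation (\<lambda>\<omega>. \<Sum>j\<in>UNIV. L2_set (\<lambda>i. X (i, j) \<omega>) UNIV)" (is "?L \<le> 2 * ?R")
proof -
  let ?c = "real (card (signs :: ('m \<Rightarrow> real) set))"
  \<comment> \<open>Row \<open>i\<close> is encoded as the restriction of the matrix to the block
    \<open>{i} \<times> UNIV\<close>; the blocks are disjoint, so the rows inherit independence from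
    the entries.\<close>
  let ?V = "\<lambda>i \<omega>. \<lambda>p\<in>{i} \<times> UNIV. X p \<omega>"
  let ?f = "\<lambda>i u v. \<bar>\<Sum>j\<in>UNIV. v (i, j) * u j\<bar> :: real"
  have V: "indep_vars (\<lambda>i. PiM ({i} \<times> UNIV) (\<lambda>_. borel)) ?V UNIV"
    by (rule indep_vars_restrict[OF indep]) (auto simp: disjoint_family_on_def)
  have "?c * expectation (\<lambda>\<omega>. MAX u\<in>signs.
        (\<Sum>i\<in>UNIV. ?f i u (?V i \<omega>)) - expectation (\<lambda>\<omega>. \<Sum>i\<in>UNIV. ?f i u (?V i \<omega>))) \<le>
      2 * (\<Sum>s\<in>signs. expectation (\<lambda>\<omega>. MAX u\<in>signs. \<Sum>i\<in>UNIV. s i * ?f i u (?V i \<omega>)))"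
  proof (rule symmetrization[OF V])
    fix i :: 'm and u :: "'n \<Rightarrow> real"
    have "(\<lambda>v. v (i, j)) \<in> borel_measurable (PiM ({i} \<times> UNIV) (\<lambda>_. borel :: real measure))" for j :: 'n
      by (rule measurable_component_singleton) simp
    then show "?f i u \<in> borel_measurable (PiM ({i} \<times> UNIV) (\<lambda>_. borel))"
      by measurable
    show "integrable M (\<lambda>\<omega>. ?f i u (?V i \<omega>))"
      using int by simp
  qed auto
  then have "?c * ?L \<le> 2 * (\<Sum>s\<in>(signs :: ('m \<Rightarrow> real) set). expectation (\<lambda>\<omega>. MAX u\<in>signs.
      \<Sum>i\<in>UNIV. s i * \<bar>\<Sum>j\<in>UNIV. X (i, j) \<omega> * u j\<bar>))"
    by simp
  also have "(\<Sum>s\<in>(signs :: ('m \<Rightarrow> real) set). expectation (\<lambda>\<omega>. MAX u\<in>signs.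
      \<Sum>i\<in>UNIV. s i * \<bar>\<Sum>j\<in>UNIV. X (i, j) \<omega> * u j\<bar>)) =
    expectation (\<lambda>\<omega>. \<Sum>s\<in>(signs :: ('m \<Rightarrow> real) set). MAX u\<in>signs.
      \<Sum>i\<in>UNIV. s i * \<bar>\<Sum>j\<in>UNIV. X (i, j) \<omega> * u j\<bar>)"
    using int by (intro Bochner_Integration.integral_sum[symmetric] integrable_Max_image) auto
  also have "\<dots> \<le> expectation (\<lambda>\<omega>. ?c * (\<Sum>j\<in>UNIV. L2_set (\<lambda>i. X (i, j) \<omega>) UNIV))"
  proof (rule integral_mono)
    show "integrable M (\<lambda>\<omega>. \<Sum>s\<in>(signs :: ('m \<Rightarrow> real) set). MAX u\<in>signs.
        \<Sum>i\<in>UNIV. s i * \<bar>\<Sum>j\<in>UNIV. X (i, j) \<omega> * u j\<bar>)"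
      using int by (intro Bochner_Integration.integrable_sum integrable_Max_image) auto
    show "integrable M (\<lambda>\<omega>. ?c * (\<Sum>j\<in>UNIV. L2_set (\<lambda>i. X (i, j) \<omega>) UNIV))"
      using int by (intro integrable_mult_right Bochner_Integration.integrable_sum integrable_L2_set) auto
    fix \<omega>
    have "(\<Sum>s\<in>(signs :: ('m \<Rightarrow> real) set). MAX u\<in>signs.
          \<Sum>i\<in>UNIV. s i * \<bar>\<Sum>j\<in>UNIV. X (i, j) \<omega> * u j\<bar>) \<le>
        (\<Sum>s\<in>(signs :: ('m \<Rightarrow> real) set). MAX u\<in>signs.
          \<Sum>i\<in>UNIV. s i * (\<Sum>j\<in>UNIV. X (i, j) \<omega> * u j))"
      by (rule sum_signs_contraction) auto
    also have "\<dots> \<le> (\<Sum>s\<in>(signs :: ('m \<Rightarrow> real) set). \<Sum>j\<in>UNIV. \<bar>\<Sum>i\<in>UNIV. s i * X (i, j) \<omega>\<bar>)"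
    proof (rule sum_mono)
      fix s :: "'m \<Rightarrow> real"
      obtain u :: "'n \<Rightarrow> real" where u: "u \<in> signs"
        "(MAX u\<in>signs. \<Sum>i\<in>UNIV. s i * (\<Sum>j\<in>UNIV. X (i, j) \<omega> * u j)) =
          (\<Sum>i\<in>UNIV. s i * (\<Sum>j\<in>UNIV. X (i, j) \<omega> * u j))"
        by (rule Max_image_obtain[OF finite_signs signs_nonempty])
      \<comment> \<open>Summing over rows first exposes the coefficient of each \<open>u j\<close>,
        a signed sum of column \<open>j\<close>.\<close>
      have "(\<Sum>i\<in>UNIV. s i * (\<Sum>j\<in>UNIV. X (i, j) \<omega> * u j)) =
          (\<Sum>j\<in>UNIV. u j * (\<Sum>i\<in>UNIV. s i * X (i, j) \<omega>))"
        unfolding sum_distrib_left by (subst sum.swap) (simp add: ac_simps)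
      also have "\<dots> \<le> (\<Sum>j\<in>UNIV. \<bar>\<Sum>i\<in>UNIV. s i * X (i, j) \<omega>\<bar>)"
        by (intro sum_mono sign_mult_le_abs u(1))
      finally show "(MAX u\<in>signs. \<Sum>i\<in>UNIV. s i * (\<Sum>j\<in>UNIV. X (i, j) \<omega> * u j)) \<le>
          (\<Sum>j\<in>UNIV. \<bar>\<Sum>i\<in>UNIV. s i * X (i, j) \<omega>\<bar>)"
        using u(2) by simp
    qed
    also have "\<dots> = (\<Sum>j\<in>UNIV. \<Sum>s\<in>(signs :: ('m \<Rightarrow> real) set). \<bar>\<Sum>i\<in>UNIV. s i * X (i, j) \<omega>\<bar>)"
      by (rule sum.swap)
    also have "\<dots> \<le> (\<Sum>j\<in>UNIV. ?c * L2_set (\<lambda>i. X (i, j) \<omega>) UNIV)"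
      unfolding L2_set_def by (intro sum_mono sum_signs_abs_le)
    finally show "(\<Sum>s\<in>(signs :: ('m \<Rightarrow> real) set). MAX u\<in>signs.
          \<Sum>i\<in>UNIV. s i * \<bar>\<Sum>j\<in>UNIV. X (i, j) \<omega> * u j\<bar>) \<le>
        ?c * (\<Sum>j\<in>UNIV. L2_set (\<lambda>i. X (i, j) \<omega>) UNIV)"
      by (simp add: sum_distrib_left)
  qed
  finally have "?c * ?L \<le> ?c * (2 * ?R)"
    by simp
  then show ?thesis
    using card_signs_pos[where 'k = 'm] by (simp only: mult_le_cancel_left_pos)
qed

text \<open>The bound on the mean of \<open>?S u\<close> is the same for every sign vector
  \<open>u\<close>, so it leaves the maximum as a constant; the centered maximum is then controlled
  by the columns.\<close>

lemma expectation_Max_l1_le: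
  fixes X :: "'m::finite \<times> 'n::finite \<Rightarrow> 'a \<Rightarrow> real"
  assumes indep: "indep_vars (\<lambda>_. borel) X UNIV"
    and int: "\<And>p. integrable M (X p)"
    and mean: "\<And>p. expectation (X p) = 0"
  shows "expectation (\<lambda>\<omega>. MAX u\<in>signs. \<Sum>i\<in>UNIV. \<bar>\<Sum>j\<in>UNIV. X (i, j) \<omega> * u j\<bar>) \<le>
    2 * expectation (\<lambda>\<omega>. (\<Sum>j\<in>UNIV. L2_set (\<lambda>i. X (i, j) \<omega>) UNIV) +
      (\<Sum>i\<in>UNIV. L2_set (\<lambda>j. X (i, j) \<omega>) UNIV))"
proof -
  let ?S = "\<lambda>u \<omega>. \<Sum>i\<in>UNIV. \<bar>\<Sum>j\<in>UNIV. X (i, j) \<omega> * u j\<bar>"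
  let ?C = "\<lambda>\<omega>. \<Sum>j\<in>UNIV. L2_set (\<lambda>i. X (i, j) \<omega>) UNIV"
  let ?R = "\<lambda>\<omega>. \<Sum>i\<in>UNIV. L2_set (\<lambda>j. X (i, j) \<omega>) UNIV"
  have S: "integrable M (?S u)" for u
    using int by simp
  have CR: "integrable M ?C" "integrable M ?R"
    using int by (auto intro!: Bochner_Integration.integrable_sum integrable_L2_set)
  \<comment> \<open>Singleton blocks \<open>{(i, j)}\<close> reindex the entries of row
    \<open>i\<close> by the column \<open>j\<close> alone.\<close>
  have row: "indep_vars (\<lambda>_. borel) (\<lambda>j. X (i, j)) UNIV" for i
  proof -
    have "indep_vars (\<lambda>j. PiM {(i, j)} (\<lambda>_. borel)) (\<lambda>j \<omega>. \<lambda>p\<in>{(i, j)}. X p \<omega>) UNIV"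
      by (rule indep_vars_restrict[OF indep]) (auto simp: disjoint_family_on_def)
    then have "indep_vars (\<lambda>_. borel) (\<lambda>j \<omega>. (\<lambda>p\<in>{(i, j)}. X p \<omega>) (i, j)) UNIV"
      by (rule indep_vars_compose2) (rule measurable_component_singleton, simp)
    then show ?thesis by simp
  qed
  have mean_bound: "expectation (?S u) \<le> 2 * expectation ?R" if u: "u \<in> signs" for u
  proof -
    have "expectation (?S u) = (\<Sum>i\<in>UNIV. expectation (\<lambda>\<omega>. \<bar>\<Sum>j\<in>UNIV. X (i, j) \<omega> * u j\<bar>))"
      using int by (intro Bochner_Integration.integral_sum) auto
    also have "\<dots> \<le> (\<Sum>i\<in>UNIV. 2 * expectation (\<lambda>\<omega>. L2_set (\<lambda>j. X (i, j) \<omega>) UNIV))"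
      by (intro sum_mono expectation_abs_sum_le row int mean u)
    also have "\<dots> = 2 * expectation ?R"
      using int by (subst Bochner_Integration.integral_sum) (auto intro: integrable_L2_set simp: sum_distrib_left)
    finally show ?thesis .
  qed
  have "expectation (\<lambda>\<omega>. MAX u\<in>signs. ?S u \<omega>) \<le>
      expectation (\<lambda>\<omega>. (MAX u\<in>signs. ?S u \<omega> - expectation (?S u)) + 2 * expectation ?R)"
  proof (rule integral_mono)
    show "integrable M (\<lambda>\<omega>. MAX u\<in>signs. ?S u \<omega>)"
      by (intro integrable_Max_image S) auto
    show "integrable M (\<lambda>\<omega>. (MAX u\<in>signs. ?S u \<omega> - expectation (?S u)) + 2 * expectation ?R)"
      by (intro Bochner_Integration.integrable_add integrable_Max_image
          Bochner_Integration.integrable_diff S integrable_const) auto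
    fix \<omega>
    obtain u :: "'n \<Rightarrow> real" where u: "u \<in> signs" "(MAX u\<in>signs. ?S u \<omega>) = ?S u \<omega>"
      by (rule Max_image_obtain[OF finite_signs signs_nonempty])
    have "?S u \<omega> - expectation (?S u) \<le> (MAX u\<in>signs. ?S u \<omega> - expectation (?S u))"
      by (rule Max_image_ge[OF finite_signs u(1)])
    then show "(MAX u\<in>signs. ?S u \<omega>) \<le> (MAX u\<in>signs. ?S u \<omega> - expectation (?S u)) + 2 * expectation ?R"
      using u(2) mean_bound[OF u(1)] by linarith
  qed
  also have "\<dots> = expectation (\<lambda>\<omega>. MAX u\<in>signs. ?S u \<omega> - expectation (?S u)) + 2 * expectation ?R"
    by (subst Bochner_Integration.integral_add)
      (auto simp: prob_space intro!: integrable_Max_image Bochner_Integration.integrable_diff S)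
  also have "\<dots> \<le> 2 * expectation ?C + 2 * expectation ?R"
    by (intro add_right_mono expectation_Max_centered_l1_le indep int)
  also have "\<dots> = 2 * expectation (\<lambda>\<omega>. ?C \<omega> + ?R \<omega>)"
    using CR by simp
  finally show ?thesis .
qed

end

section \<open>Conclusion for the random matrix\<close>

lemma colnorm_eq_sum_L2_set: "colnorm A = (\<Sum>j\<in>UNIV. L2_set (\<lambda>i. A $ i $ j) UNIV)"
  by (simp add: colnorm_def norm_vec_def L2_set_def column_def)

theorem theorem3:
  fixes M :: "'a measure" and Z :: "'a \<Rightarrow> real ^ 'n ^ 'm"
  assumes "prob_space M"
    and "prob_space.indep_vars M (\<lambda>_. borel) (\<lambda>(i, j) \<omega>. Z \<omega> $ i $ j) (UNIV :: ('m \<times> 'n) set)"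
    and "\<And>i j. integrable M (\<lambda>\<omega>. Z \<omega> $ i $ j)"
    and "\<And>i j. prob_space.expectation M (\<lambda>\<omega>. Z \<omega> $ i $ j) = 0"
  shows "prob_space.expectation M (\<lambda>\<omega>. norm_inf_1 (Z \<omega>))
    \<le> 2 * prob_space.expectation M (\<lambda>\<omega>. colnorm (Z \<omega>) + colnorm (transpose (Z \<omega>)))"
proof -
  interpret prob_space M by fact
  let ?X = "\<lambda>(i, j) \<omega>. Z \<omega> $ i $ j"
  let ?S = "\<lambda>\<omega>. MAX u\<in>signs. \<Sum>i\<in>UNIV. \<bar>\<Sum>j\<in>UNIV. Z \<omega> $ i $ j * u j\<bar>"
  have "expectation (\<lambda>\<omega>. norm_inf_1 (Z \<omega>)) \<le> expectation ?S"
  \<comment> \<open>This form of monotonicity also covers a non-integrable left side, whose Bochner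
    integral is 0 by convention. That case is the reason for checking that \<open>?S\<close> is
    nonnegative.\<close>
  proof (rule integral_mono')
    show "integrable M ?S"
      using assms(3) by (intro integrable_Max_image) auto
    show "0 \<le> ?S \<omega>" for \<omega>
      by (rule order_trans[OF _ Max_image_ge[OF finite_signs const_one_in_signs]]) (simp add: sum_nonneg)
  qed (rule norm_inf_1_le_Max_signs)
  also have "\<dots> \<le> 2 * expectation (\<lambda>\<omega>. colnorm (Z \<omega>) + colnorm (transpose (Z \<omega>)))"
    using expectation_Max_l1_le[OF assms(2)] assms(3,4)
    by (simp add: colnorm_eq_sum_L2_set transpose_def split_paired_all)
  finally show ?thesis .
qed

end
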